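(* Consider the system $$\dot x=P:=Ayz+Cz-\sigma x,\qquad \dot y=Q:=-xz+R_a-y,\qquad \dot z=R:=-z+xy$$ with real (not necessarily positive) parameters $A,C,\sigma,R_a$. Then: (1) if $R_a=0$ and $\sigma=1$, the system has the Darboux polynomial $f=y^2+z^2$ with constant cofactor $-2$; (2) if $C=0$ and $\sigma=1$, the system has the Darboux polynomial $f=x^2-Az^2$ with constant cofactor $-2$; (3) if $R_a=C=0$ and $\sigma=1$, the system has the rational first integral $\Phi=(y^2+z^2)/(x^2-Az^2)$.
   Context: A Darboux polynomial with cofactor $K$ (a polynomial) is a nonzero polynomial $f\in\mathbb{R}[x,y,z]$ with $\frac{\partial f}{\partial x}P+\frac{\partial f}{\partial y}Q+\frac{\partial f}{\partial z}R=Kf$. A rational first integral is a nonconstant rational function $\Phi$ with $\frac{\partial \Phi}{\partial x}P+\frac{\partial \Phi}{\partial y}Q+\frac{\partial \Phi}{\partial z}R=0$ on its domain of definition. *)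

theory Defs
  imports "HOL-Analysis.Analysis"
begin

(* Elements of R[x,y,z] are represented by polynomial functions on R^3
   (library predicate real_polynomial_function); over the infinite field R the
   two coincide, so a polynomial is nonzero iff it is nonzero at some point. *)

type_synonym point = "real \<times> real \<times> real"

definition partial_x :: "(point \<Rightarrow> real) \<Rightarrow> point \<Rightarrow> real" where
  "partial_x f = (\<lambda>(x, y, z). deriv (\<lambda>t. f (t, y, z)) x)"

definition partial_y :: "(point \<Rightarrow> real) \<Rightarrow> point \<Rightarrow> real" where
  "partial_y f = (\<lambda>(x, y, z). deriv (\<lambda>t. f (x, t, z)) y)"

definition partial_z :: "(point \<Rightarrow> real) \<Rightarrow> point \<Rightarrow> real" where
  "partial_z f = (\<lambda>(x, y, z). deriv (\<lambda>t. f (x, y, t)) z)"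

definition darboux_polynomial ::
  "(point \<Rightarrow> real) \<Rightarrow> (point \<Rightarrow> real) \<Rightarrow> (point \<Rightarrow> real) \<Rightarrow>
   (point \<Rightarrow> real) \<Rightarrow> (point \<Rightarrow> real) \<Rightarrow> bool" where
  "darboux_polynomial P Q R f K \<longleftrightarrow>
     real_polynomial_function f \<and> real_polynomial_function K \<and>
     (\<exists>p. f p \<noteq> 0) \<and>
     (\<forall>p. partial_x f p * P p + partial_y f p * Q p + partial_z f p * R p = K p * f p)"

(* The rational function g / h is given by its numerator and denominator, with
   domain of definition {p. h p \<noteq> 0}.  Nonconstancy and the differential equation
   are required on that open set only, so the value of division by zero plays no
   role, and all partial derivatives involved exist. *)

definition rational_first_integral ::
  "(point \<Rightarrow> real) \<Rightarrow> (point \<Rightarrow> real) \<Rightarrow> (point \<Rightarrow> real) \<Rightarrow>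
   (point \<Rightarrow> real) \<Rightarrow> (point \<Rightarrow> real) \<Rightarrow> bool" where
  "rational_first_integral P Q R g h \<longleftrightarrow>
     real_polynomial_function g \<and> real_polynomial_function h \<and>
     (\<exists>p. h p \<noteq> 0) \<and>
     \<not> (\<exists>c. \<forall>p. h p \<noteq> 0 \<longrightarrow> g p / h p = c) \<and>
     (let \<Phi> = (\<lambda>p. g p / h p) in
       \<forall>p. h p \<noteq> 0 \<longrightarrow>
         partial_x \<Phi> p * P p + partial_y \<Phi> p * Q p + partial_z \<Phi> p * R p = 0)"

end

(* A quotient of two Darboux polynomials with the same cofactor K is constant along the flow:
   by the quotient rule its derivative has numerator (K g) h - g (K h) = 0. *)
theory Submission
  imports Defs
begin

text \<open>Both polynomials are diagonal quadratic forms
  \<open>a * x\<^sup>2 + b * y\<^sup>2 + c * z\<^sup>2\<close>, whose derivative along the field is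
  2axP + 2byQ + 2czR. For the chosen coefficients the cubic xyz terms cancel, and the parameter
  conditions leave exactly -2 times the form (\<open>partial_quadratic\<close> and expansion). Since
  the two cofactors agree, the quotient is annihilated by the field
  (\<open>darboux_quotient_first_integral\<close>); it is nonconstant because it takes two values on
  the plane z = 0.\<close>

lemma field_differentiable_along_line:
  fixes f :: "point \<Rightarrow> real" and l :: "real \<Rightarrow> point"
  assumes "real_polynomial_function f" "l differentiable (at t)"
  shows "(\<lambda>t. f (l t)) field_differentiable (at t)"
proof -
  have "f differentiable (at (l t))"
    using assms(1) by (rule differentiable_at_real_polynomial_function)
  then have "(f \<circ> l) differentiable (at t)"
    using assms(2) by (intro differentiable_chain_at)
  then show ?thesis
    by (simp add: o_def real_differentiable_def field_differentiable_def)
qed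

text \<open>\<open>deriv\<close> is an arbitrary value where no derivative exists, so its quotient
  rule requires differentiability of every one-variable slice. Each slice is the polynomial composed
  with a line parallel to an axis.\<close>

lemma field_differentiable_coordinate_lines:
  assumes "real_polynomial_function f"
  shows "(\<lambda>t. f (t, y, z)) field_differentiable (at s)"
    and "(\<lambda>t. f (x, t, z)) field_differentiable (at s)"
    and "(\<lambda>t. f (x, y, t)) field_differentiable (at s)"
  by (rule field_differentiable_along_line[OF assms];
      intro derivative_intros differentiable_Pair differentiable_const differentiable_ident)+

lemma partial_divide:
  assumes "real_polynomial_function g" "real_polynomial_function h" "h p \<noteq> 0"
  shows "partial_x (\<lambda>p. g p / h p) p = (partial_x g p * h p - g p * partial_x h p) / (h p)\<^sup>2"
    and "partial_y (\<lambda>p. g p / h p) p = (partial_y g p * h p - g p * partial_y h p) / (h p)\<^sup>2"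
    and "partial_z (\<lambda>p. g p / h p) p = (partial_z g p * h p - g p * partial_z h p) / (h p)\<^sup>2"
  using assms
  by (cases p; simp add: partial_x_def partial_y_def partial_z_def
      field_differentiable_coordinate_lines)+

lemma darboux_quotient_first_integral:
  assumes g: "darboux_polynomial P Q R g K" and h: "darboux_polynomial P Q R h K"
    and nonconst: "\<not> (\<exists>c. \<forall>p. h p \<noteq> 0 \<longrightarrow> g p / h p = c)"
  shows "rational_first_integral P Q R g h"
proof -
  have poly: "real_polynomial_function g" "real_polynomial_function h" and nz: "\<exists>p. h p \<noteq> 0"
    using g h by (auto simp: darboux_polynomial_def)
  have "partial_x (\<lambda>p. g p / h p) p * P p + partial_y (\<lambda>p. g p / h p) p * Q p
      + partial_z (\<lambda>p. g p / h p) p * R p = 0" (is "?L = 0") if "h p \<noteq> 0" for p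
  proof -
    \<comment> \<open>Collecting the three quotient rules over \<open>(h p)\<^sup>2\<close> exposes
      the derivatives of \<open>g\<close> and \<open>h\<close> along the field, to which the
      cofactor equations apply.\<close>
    have "?L = ((partial_x g p * P p + partial_y g p * Q p + partial_z g p * R p) * h p
        - g p * (partial_x h p * P p + partial_y h p * Q p + partial_z h p * R p)) / (h p)\<^sup>2"
      unfolding partial_divide[OF poly that]
      by (simp add: add_divide_distrib diff_divide_distrib algebra_simps)
    also have "\<dots> = ((K p * g p) * h p - g p * (K p * h p)) / (h p)\<^sup>2"
      using g h unfolding darboux_polynomial_def by metis
    also have "\<dots> = 0"
      by simp
    finally show ?thesis .
  qed
  then show ?thesis
    using poly nz nonconst by (simp add: rational_first_integral_def)
qed

lemma real_polynomial_function_coordinates: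
  "real_polynomial_function ((\<lambda>(x, y, z). x) :: point \<Rightarrow> real)"
  "real_polynomial_function ((\<lambda>(x, y, z). y) :: point \<Rightarrow> real)"
  "real_polynomial_function ((\<lambda>(x, y, z). z) :: point \<Rightarrow> real)"
  by (auto simp: case_prod_unfold intro!: real_polynomial_function.intros(1)
      bounded_linear_fst bounded_linear_fst_comp bounded_linear_snd_comp bounded_linear_ident)

text \<open>One family of diagonal forms serves both Darboux polynomials.\<close>

lemma real_polynomial_function_quadratic:
  fixes a b c :: real
  shows "real_polynomial_function (\<lambda>(x, y, z). a * x\<^sup>2 + b * y\<^sup>2 + c * z\<^sup>2)"
proof -
  note coords = real_polynomial_function_coordinates[unfolded case_prod_unfold]
  show ?thesis
    unfolding case_prod_unfold
    by (intro real_polynomial_function.intros(2-4) real_polynomial_function_power coords)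
qed

lemma partial_quadratic:
  fixes a b c :: real
  shows "partial_x (\<lambda>(x, y, z). a * x\<^sup>2 + b * y\<^sup>2 + c * z\<^sup>2) = (\<lambda>(x, y, z). 2 * a * x)"
    and "partial_y (\<lambda>(x, y, z). a * x\<^sup>2 + b * y\<^sup>2 + c * z\<^sup>2) = (\<lambda>(x, y, z). 2 * b * y)"
    and "partial_z (\<lambda>(x, y, z). a * x\<^sup>2 + b * y\<^sup>2 + c * z\<^sup>2) = (\<lambda>(x, y, z). 2 * c * z)"
  unfolding partial_x_def partial_y_def partial_z_def
  by (auto simp: fun_eq_iff intro!: DERIV_imp_deriv derivative_eq_intros)

theorem mainTheorem9:
  fixes A C \<sigma> Ra :: real
    and P Q R :: "real \<times> real \<times> real \<Rightarrow> real"
  assumes P: "P = (\<lambda>(x, y, z). A * y * z + C * z - \<sigma> * x)"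
    and Q: "Q = (\<lambda>(x, y, z). - x * z + Ra - y)"
    and R: "R = (\<lambda>(x, y, z). - z + x * y)"
  shows
    "(Ra = 0 \<and> \<sigma> = 1 \<longrightarrow>
        darboux_polynomial P Q R (\<lambda>(x, y, z). y\<^sup>2 + z\<^sup>2) (\<lambda>_. - 2)) \<and>
     (C = 0 \<and> \<sigma> = 1 \<longrightarrow>
        darboux_polynomial P Q R (\<lambda>(x, y, z). x\<^sup>2 - A * z\<^sup>2) (\<lambda>_. - 2)) \<and>
     (Ra = 0 \<and> C = 0 \<and> \<sigma> = 1 \<longrightarrow>
        rational_first_integral P Q R
          (\<lambda>(x, y, z). y\<^sup>2 + z\<^sup>2) (\<lambda>(x, y, z). x\<^sup>2 - A * z\<^sup>2))"
proof -
  let ?f = "(\<lambda>(x, y, z). y\<^sup>2 + z\<^sup>2) :: point \<Rightarrow> real"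
  let ?h = "(\<lambda>(x, y, z). x\<^sup>2 - A * z\<^sup>2) :: point \<Rightarrow> real"
  \<comment> \<open>The coefficients 0 and 1 are written out so that the facts on diagonal forms
    apply by rewriting.\<close>
  have f_eq: "?f = (\<lambda>(x, y, z). 0 * x\<^sup>2 + 1 * y\<^sup>2 + 1 * z\<^sup>2)"
    and h_eq: "?h = (\<lambda>(x, y, z). 1 * x\<^sup>2 + 0 * y\<^sup>2 + (- A) * z\<^sup>2)"
    by (auto simp: fun_eq_iff)
  have f_nz: "\<exists>p. ?f p \<noteq> 0"
    by (rule exI[of _ "(0, 1, 0)"]) simp
  have h_nz: "\<exists>p. ?h p \<noteq> 0"
    by (rule exI[of _ "(1, 0, 0)"]) simp
  have f: "darboux_polynomial P Q R ?f (\<lambda>_. - 2)" if "Ra = 0"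
    unfolding darboux_polynomial_def
  proof (intro conjI f_nz)
    show "real_polynomial_function ?f"
      unfolding f_eq by (rule real_polynomial_function_quadratic)
    \<comment> \<open>The left side is 2y(-xz + Ra - y) + 2z(-z + xy): the xyz terms cancel and 2 Ra
      y vanishes.\<close>
    show "\<forall>p. partial_x ?f p * P p + partial_y ?f p * Q p + partial_z ?f p * R p = - 2 * ?f p"
      unfolding f_eq partial_quadratic
      using that by (auto simp: P Q R algebra_simps power2_eq_square)
  qed (rule real_polynomial_function.intros(2))
  have h: "darboux_polynomial P Q R ?h (\<lambda>_. - 2)" if "C = 0" "\<sigma> = 1"
    unfolding darboux_polynomial_def
  proof (intro conjI h_nz)
    show "real_polynomial_function ?h"
      unfolding h_eq by (rule real_polynomial_function_quadratic)
    \<comment> \<open>The left side is 2x(Ayz + Cz - \<sigma>x) - 2Az(-z + xy): the terms in Axyz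
      cancel, 2Cxz vanishes, and \<sigma> = 1 matches the x and z squares.\<close>
    show "\<forall>p. partial_x ?h p * P p + partial_y ?h p * Q p + partial_z ?h p * R p = - 2 * ?h p"
      unfolding h_eq partial_quadratic
      using that by (auto simp: P Q R algebra_simps power2_eq_square)
  qed (rule real_polynomial_function.intros(2))
  have nonconst: "\<not> (\<exists>c. \<forall>p. ?h p \<noteq> 0 \<longrightarrow> ?f p / ?h p = c)"
  proof
    assume "\<exists>c. \<forall>p. ?h p \<noteq> 0 \<longrightarrow> ?f p / ?h p = c"
    then obtain c where c: "\<And>p. ?h p \<noteq> 0 \<Longrightarrow> ?f p / ?h p = c"
      by blast
    \<comment> \<open>With z = 0 and x = 1 the denominator is 1 whatever \<open>A\<close> is, and
      the quotient equals the square of y, here 0 and 1.\<close>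
    from c[of "(1, 0, 0)"] c[of "(1, 1, 0)"] show False
      by simp
  qed
  have "rational_first_integral P Q R ?f ?h" if "Ra = 0" "C = 0" "\<sigma> = 1"
    by (rule darboux_quotient_first_integral[OF f[OF that(1)] h[OF that(2,3)] nonconst])
  with f h show ?thesis
    by blast
qed

end
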